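(* Let $\mathcal V\subseteq\mathbb R^n$ be a regular space on $E=\{1,\dots,n\}$, let $r\in E$, and let $P,Q\in\mathcal V$ be arbitrary $r$-paths. Then: (i) $|P+Q|=|P|+|Q|$ if and only if $P$ and $Q$ are conformal. (ii) $|P\wedge Q|+|P\vee Q|\le |P|+|Q|$. (iii) $|P\wedge Q|+|P\vee Q|<|P|+|Q|$ if $P$ and $Q$ are nonconformal.
   Context: Let $\mathcal V\subseteq\mathbb R^n$ be a linear subspace and $E=\{1,\dots,n\}$. The support of $x\in\mathbb R^n$ is $\|x\|=\{j\in E\mid x_j\ne 0\}$. A nonzero $x\in\mathcal V$ is elementary if no nonzero $y\in\mathcal V$ has support properly contained in $\|x\|$. A primitive vector is an elementary vector of $\mathcal V$ all of whose components lie in $\{-1,0,+1\}$. $\mathcal V$ is regular if every elementary vector is a scalar multiple of a primitive vector (equivalently, $\mathcal V$ is the kernel, or the row space, of a totally unimodular matrix). The length of $x\in\mathbb R^n$ is $|x|=\sum_{j=1}^n|x_j|$. A vector $x\in\mathbb R^n$ conforms to $y\in\mathbb R^n$ if $x_jy_j>0$ whenever $x_j\ne0$. It is a known fact that in a regular space every integral vector of $\mathcal V$ is a sum of primitive vectors each conforming to it. Fix $r\in E$. An $r$-path is a primitive vector $P\in\mathcal V$ with $P_r=+1$. Two $r$-paths $P,Q$ are nonconformal if $P_jQ_j=-1$ for some $j\in E$; otherwise they are conformal. For $r$-paths $P,Q$, write $P+Q=p^1+\dots+p^k$ with each $p^i$ primitive and conforming to $P+Q$. Since $(P+Q)_r=2$,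 exactly two of these summands have $r$-component $+1$ (they may coincide as vectors); these two summands, which are $r$-paths, are denoted $P\wedge Q$ and $P\vee Q$. The decomposition, and the naming of the two summands, is an arbitrary choice; the statement holds for any such choice. *)

theory Defs
  imports "HOL-Analysis.Analysis" "HOL-Library.Multiset"
begin

definition supp :: "real ^ 'n \<Rightarrow> 'n set" where
  "supp x = {j. x $ j \<noteq> 0}"

definition elementary :: "(real ^ 'n) set \<Rightarrow> real ^ 'n \<Rightarrow> bool" where
  "elementary V x \<longleftrightarrow> x \<in> V \<and> x \<noteq> 0 \<and> \<not> (\<exists>y\<in>V. y \<noteq> 0 \<and> supp y \<subset> supp x)"

definition primitive :: "(real ^ 'n) set \<Rightarrow> real ^ 'n \<Rightarrow> bool" where
  "primitive V x \<longleftrightarrow> elementary V x \<and> (\<forall>j. x $ j \<in> {-1, 0, 1})"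

definition regular_subspace :: "(real ^ 'n) set \<Rightarrow> bool" where
  "regular_subspace V \<longleftrightarrow> subspace V \<and>
     (\<forall>x. elementary V x \<longrightarrow> (\<exists>c p. primitive V p \<and> x = c *\<^sub>R p))"

text \<open>The length is the 1-norm, not the Euclidean \<^const>\<open>norm\<close> of the library.\<close>

definition vlength :: "real ^ 'n \<Rightarrow> real" where
  "vlength x = (\<Sum>j\<in>UNIV. \<bar>x $ j\<bar>)"

definition conforms_to :: "real ^ 'n \<Rightarrow> real ^ 'n \<Rightarrow> bool" where
  "conforms_to x y \<longleftrightarrow> (\<forall>j. x $ j \<noteq> 0 \<longrightarrow> x $ j * y $ j > 0)"

definition r_path :: "(real ^ 'n) set \<Rightarrow> 'n \<Rightarrow> real ^ 'n \<Rightarrow> bool" where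
  "r_path V r P \<longleftrightarrow> primitive V P \<and> P $ r = 1"

definition nonconformal :: "real ^ 'n \<Rightarrow> real ^ 'n \<Rightarrow> bool" where
  "nonconformal P Q \<longleftrightarrow> (\<exists>j. P $ j * Q $ j = -1)"

abbreviation conformal :: "real ^ 'n \<Rightarrow> real ^ 'n \<Rightarrow> bool" where
  "conformal P Q \<equiv> \<not> nonconformal P Q"

text \<open>Summands may repeat, so a decomposition is a multiset.\<close>

definition conformal_decomposition ::
    "(real ^ 'n) set \<Rightarrow> real ^ 'n \<Rightarrow> (real ^ 'n) multiset \<Rightarrow> bool" where
  "conformal_decomposition V x D \<longleftrightarrow>
     (\<forall>p\<in>#D. primitive V p \<and> conforms_to p x) \<and> sum_mset D = x"

text \<open>The vectors \<open>P \<and> Q\<close> and \<open>P \<or> Q\<close> depend on an arbitrary choice of a decomposition of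
  \<open>P + Q\<close> and of an order of its two summands with \<open>r\<close>-component \<open>1\<close>. The predicate says that
  \<open>M\<close> and \<open>J\<close> are \<open>P \<and> Q\<close> and \<open>P \<or> Q\<close> for some such choice; \<open>M = J\<close> is possible.\<close>

definition meet_join ::
    "(real ^ 'n) set \<Rightarrow> 'n \<Rightarrow> real ^ 'n \<Rightarrow> real ^ 'n \<Rightarrow> real ^ 'n \<Rightarrow> real ^ 'n \<Rightarrow> bool" where
  "meet_join V r P Q M J \<longleftrightarrow>
     (\<exists>D. conformal_decomposition V (P + Q) D \<and> filter_mset (\<lambda>p. p $ r = 1) D = {#M, J#})"

end

theory Submission
  imports Defs
begin

text \<open>A conformal decomposition of \<open>P + Q\<close> involves no cancellation: in each coordinate the nonzero
  entries of the summands all have the same sign, so the lengths of the summands add up to \<open>\<bar>P + Q\<bar>\<close>. Two of the summands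
  are \<open>P \<and> Q\<close> and \<open>P \<or> Q\<close>, hence their lengths add up to at most \<open>\<bar>P + Q\<bar>\<close>
  (\<open>vlength_meet_join_le\<close>), which the triangle inequality bounds by \<open>\<bar>P\<bar> + \<bar>Q\<bar>\<close>. The triangle
  inequality is strict exactly when some component has opposite signs in the two vectors
  (\<open>vlength_add_eq_iff\<close>); for components in \<open>{-1, 0, 1}\<close> this means that the product of the two
  components is \<open>-1\<close>, that is, that \<open>P\<close> and \<open>Q\<close> are nonconformal.\<close>

lemma vlength_nonneg: "0 \<le> vlength x"
  by (simp add: vlength_def sum_nonneg)

lemma vlength_triangle: "vlength (x + y) \<le> vlength x + vlength y"
  unfolding vlength_def sum.distrib[symmetric]
  by (rule sum_mono) (simp add: abs_triangle_ineq)

lemma vlength_add_eq_iff: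
  "vlength (x + y) = vlength x + vlength y \<longleftrightarrow> (\<forall>j. 0 \<le> x $ j * y $ j)"
proof -
  have "vlength (x + y) = vlength x + vlength y \<longleftrightarrow>
      (\<Sum>j\<in>UNIV. \<bar>x $ j\<bar> + \<bar>y $ j\<bar> - \<bar>x $ j + y $ j\<bar>) = 0"
    by (auto simp: vlength_def sum.distrib sum_subtractf)
  also have "\<dots> \<longleftrightarrow> (\<forall>j. \<bar>x $ j\<bar> + \<bar>y $ j\<bar> - \<bar>x $ j + y $ j\<bar> = 0)"
    by (subst sum_nonneg_eq_0_iff) (auto simp: abs_triangle_ineq)
  also have "\<dots> \<longleftrightarrow> (\<forall>j. 0 \<le> x $ j * y $ j)"
    by (intro all_cong1) (auto simp: abs_if zero_le_mult_iff)
  finally show ?thesis .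
qed

text \<open>On the vectors conforming to \<open>x\<close> the length agrees with a linear functional, the inner
  product with the sign vector of \<open>x\<close>; this is why lengths are additive along a conformal
  decomposition.\<close>

lemma vlength_conforms_to:
  assumes "conforms_to p x"
  shows "vlength p = p \<bullet> (\<chi> j. sgn (x $ j))"
proof -
  have "\<bar>p $ j\<bar> = p $ j * sgn (x $ j)" for j
    using assms[unfolded conforms_to_def, rule_format, of j]
    by (cases "p $ j = 0") (auto simp: sgn_if zero_less_mult_iff)
  then show ?thesis
    by (simp add: vlength_def inner_vec_def)
qed

lemma sum_mset_vlength:
  assumes "\<forall>p\<in>#D. conforms_to p x" and "sum_mset D = x"
  shows "(\<Sum>p\<in>#D. vlength p) = vlength x"
proof -
  let ?s = "\<chi> j. sgn (x $ j)"
  have "(\<Sum>p\<in>#D. vlength p) = (\<Sum>p\<in>#D. p \<bullet> ?s)"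
    by (rule arg_cong[where f = sum_mset, OF image_mset_cong])
      (rule vlength_conforms_to[OF assms(1)[rule_format]])
  also have "\<dots> = sum_mset D \<bullet> ?s"
    by (induction D) (auto simp: inner_add_left)
  also have "\<dots> = vlength x"
    unfolding assms(2) by (rule vlength_conforms_to[symmetric])
      (auto simp: conforms_to_def zero_less_mult_iff linorder_neq_iff)
  finally show ?thesis .
qed

lemma vlength_meet_join_le:
  assumes "meet_join V r P Q M J"
  shows "vlength M + vlength J \<le> vlength (P + Q)"
proof -
  from assms obtain D where D: "conformal_decomposition V (P + Q) D"
    and MJ: "filter_mset (\<lambda>p. p $ r = 1) D = {#M, J#}"
    by (auto simp: meet_join_def)
  define R where "R = filter_mset (\<lambda>p. p $ r \<noteq> 1) D"
  have "D = {#M, J#} + R"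
    using multiset_partition[of D "\<lambda>p. p $ r = 1"] MJ by (simp add: R_def)
  then have "(\<Sum>p\<in>#D. vlength p) = vlength M + vlength J + (\<Sum>p\<in>#R. vlength p)"
    by (simp add: add.assoc)
  moreover have "0 \<le> (\<Sum>p\<in>#R. vlength p)"
    by (induction R) (auto simp: vlength_nonneg)
  moreover have "(\<Sum>p\<in>#D. vlength p) = vlength (P + Q)"
    using D by (intro sum_mset_vlength) (auto simp: conformal_decomposition_def)
  ultimately show ?thesis
    by simp
qed

lemma conformal_iff_primitive:
  assumes "primitive V P" and "primitive V Q"
  shows "conformal P Q \<longleftrightarrow> (\<forall>j. 0 \<le> P $ j * Q $ j)"
proof -
  have "P $ j * Q $ j \<noteq> -1 \<longleftrightarrow> 0 \<le> P $ j * Q $ j" for j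
  proof -
    have "P $ j \<in> {-1, 0, 1}" "Q $ j \<in> {-1, 0, 1}"
      using assms unfolding primitive_def by blast+
    then show ?thesis
      by auto
  qed
  then show ?thesis
    by (simp add: nonconformal_def)
qed

theorem lemma4:
  fixes V :: "(real ^ 'n) set" and r :: 'n and P Q :: "real ^ 'n"
  assumes "regular_subspace V"
    and "r_path V r P"
    and "r_path V r Q"
  shows "(vlength (P + Q) = vlength P + vlength Q \<longleftrightarrow> conformal P Q)
    \<and> (\<forall>M J. meet_join V r P Q M J \<longrightarrow> vlength M + vlength J \<le> vlength P + vlength Q)
    \<and> (\<forall>M J. meet_join V r P Q M J \<longrightarrow> nonconformal P Q \<longrightarrow>
          vlength M + vlength J < vlength P + vlength Q)"
proof -
  have "vlength (P + Q) = vlength P + vlength Q \<longleftrightarrow> conformal P Q"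
    using assms conformal_iff_primitive[of V P Q]
    by (simp add: r_path_def vlength_add_eq_iff)
  moreover have "vlength (P + Q) \<le> vlength P + vlength Q"
    by (rule vlength_triangle)
  ultimately show ?thesis
    using vlength_meet_join_le[of V r P Q] by fastforce
qed

end
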